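(* Suppose that $A_0$ and $A_1$ are jointly definite and that $n\ge 2$. Then a vector $x^*\in\mathbb{R}^n$ is a local-nonglobal minimizer of (GTR) if and only if $x^*$ is a local-nonglobal minimizer of the corresponding problem (GTRE) with Lagrangian multiplier $\mu^*>0$ (that is, $\nabla f_0(x^* )+\mu^*\nabla f_1(x^* )=0$ with $\mu^*>0$).
   Context: Let $A_0,A_1$ be real symmetric $n\times n$ matrices, $b_0,b_1\in\mathbb{R}^n$, $c_1\in\mathbb{R}$, $f_0(x)=x^TA_0x+2b_0^Tx$, $f_1(x)=x^TA_1x+2b_1^Tx+c_1$. Problem (GTR) is: minimize $f_0(x)$ over $x\in\mathbb{R}^n$ subject to $f_1(x)\le 0$. Problem (GTRE) is: minimize $f_0(x)$ over $x\in\mathbb{R}^n$ subject to $f_1(x)=0$. A local-nonglobal minimizer of a problem is a feasible point that is a local minimizer but not a global minimizer (a global minimizer being a feasible point whose objective value is at most that of every feasible point). At a local-nonglobal minimizer $x^*$ of (GTRE) one has $\nabla f_1(x^* )\neq 0$, and its Lagrangian multiplier is the unique $\mu^*\in\mathbb{R}$ with $\nabla f_0(x^* )+\mu^*\nabla f_1(x^* )=0$. The matrices $A_0$ and $A_1$ are jointly definite if there is $\mu_1\in\mathbb{R}$ with $A_0+\mu_1A_1\succ 0$ or $A_0+\mu_1A_1\prec 0$, or equivalently (the paper's equivalent form of the definition) if there are $\mu_0,\mu_1\in\mathbb{R}$ with $\mu_0A_0+\mu_1A_1\succ 0$. *)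

theory Defs
  imports "HOL-Analysis.Analysis"
begin

definition quad :: "real ^ 'n ^ 'n \<Rightarrow> real ^ 'n \<Rightarrow> real \<Rightarrow> real ^ 'n \<Rightarrow> real" where
  "quad A b c x = x \<bullet> (A *v x) + 2 * (b \<bullet> x) + c"

definition pos_def_matrix :: "real ^ 'n ^ 'n \<Rightarrow> bool" where
  "pos_def_matrix A \<longleftrightarrow> transpose A = A \<and> (\<forall>v. v \<noteq> 0 \<longrightarrow> 0 < v \<bullet> (A *v v))"

definition neg_def_matrix :: "real ^ 'n ^ 'n \<Rightarrow> bool" where
  "neg_def_matrix A \<longleftrightarrow> transpose A = A \<and> (\<forall>v. v \<noteq> 0 \<longrightarrow> v \<bullet> (A *v v) < 0)"

definition jointly_definite :: "real ^ 'n ^ 'n \<Rightarrow> real ^ 'n ^ 'n \<Rightarrow> bool" where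
  "jointly_definite A\<^sub>0 A\<^sub>1 \<longleftrightarrow>
     (\<exists>\<mu>. pos_def_matrix (A\<^sub>0 + \<mu> *\<^sub>R A\<^sub>1) \<or> neg_def_matrix (A\<^sub>0 + \<mu> *\<^sub>R A\<^sub>1))"

definition global_minimizer :: "('a \<Rightarrow> real) \<Rightarrow> 'a set \<Rightarrow> 'a \<Rightarrow> bool" where
  "global_minimizer f S x \<longleftrightarrow> x \<in> S \<and> (\<forall>y\<in>S. f x \<le> f y)"

definition local_minimizer :: "('a::metric_space \<Rightarrow> real) \<Rightarrow> 'a set \<Rightarrow> 'a \<Rightarrow> bool" where
  "local_minimizer f S x \<longleftrightarrow>
     x \<in> S \<and> (\<exists>e>0. \<forall>y\<in>S. dist y x < e \<longrightarrow> f x \<le> f y)"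

definition local_nonglobal_minimizer ::
    "('a::metric_space \<Rightarrow> real) \<Rightarrow> 'a set \<Rightarrow> 'a \<Rightarrow> bool" where
  "local_nonglobal_minimizer f S x \<longleftrightarrow> local_minimizer f S x \<and> \<not> global_minimizer f S x"

definition GTR_feasible :: "('a \<Rightarrow> real) \<Rightarrow> 'a set" where
  "GTR_feasible f\<^sub>1 = {x. f\<^sub>1 x \<le> 0}"

definition GTRE_feasible :: "('a \<Rightarrow> real) \<Rightarrow> 'a set" where
  "GTRE_feasible f\<^sub>1 = {x. f\<^sub>1 x = 0}"

(* Arbitrary unless f is differentiable at x; gradient_quad covers the functions used here. *)
definition gradient :: "('a::real_inner \<Rightarrow> real) \<Rightarrow> 'a \<Rightarrow> 'a" where
  "gradient f x = (THE g. GDERIV f x :> g)"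

(* Where the gradient of f1 at x is nonzero, there is at most one such mu. *)
definition lagrangian_multiplier ::
    "('a::real_inner \<Rightarrow> real) \<Rightarrow> ('a \<Rightarrow> real) \<Rightarrow> 'a \<Rightarrow> real \<Rightarrow> bool" where
  "lagrangian_multiplier f\<^sub>0 f\<^sub>1 x \<mu> \<longleftrightarrow> gradient f\<^sub>0 x + \<mu> *\<^sub>R gradient f\<^sub>1 x = 0"

lemma gradient_eqI:
  assumes "GDERIV f x :> g"
  shows "gradient f x = g"
  unfolding gradient_def
proof (rule the_equality)
  show "GDERIV f x :> g" by (rule assms)
next
  fix h assume "GDERIV f x :> h"
  with assms have "(\<lambda>v. v \<bullet> h) = (\<lambda>v. v \<bullet> g)"
    unfolding gderiv_def by (rule has_derivative_unique[rotated])
  then have "v \<bullet> h = v \<bullet> g" for v by (rule fun_cong)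
  then show "h = g" by (metis vector_eq_ldot)
qed

lemma gradient_quad:
  fixes A :: "real ^ 'n ^ 'n"
  assumes "transpose A = A"
  shows "gradient (quad A b c) x = 2 *\<^sub>R (A *v x + b)"
proof (rule gradient_eqI)
  have lin: "((\<lambda>x. A *v x) has_derivative (\<lambda>v. A *v v)) (at x)"
    by (rule bounded_linear_imp_has_derivative) (rule matrix_vector_mul_bounded_linear)
  have sym: "x \<bullet> (A *v v) = v \<bullet> (A *v x)" for v
    using assms by (metis dot_lmul_matrix inner_commute transpose_matrix_vector)
  have "((\<lambda>x. x \<bullet> (A *v x) + 2 * (b \<bullet> x) + c) has_derivative
      (\<lambda>v. x \<bullet> (A *v v) + v \<bullet> (A *v x) + 2 * (b \<bullet> v))) (at x)"
    by (auto intro!: derivative_eq_intros lin)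
  moreover have "(\<lambda>v. x \<bullet> (A *v v) + v \<bullet> (A *v x) + 2 * (b \<bullet> v)) = (\<lambda>v. v \<bullet> (2 *\<^sub>R (A *v x + b)))"
    by (simp add: sym inner_add_right inner_commute[of b])
  ultimately show "GDERIV (quad A b c) x :> 2 *\<^sub>R (A *v x + b)"
    unfolding gderiv_def quad_def[abs_def] by simp
qed

end

theory Submission
  imports Defs
begin

text \<open>
  Write \<open>p = A\<^sub>0 x + b\<^sub>0\<close> and \<open>a = A\<^sub>1 x + b\<^sub>1\<close> for the half gradients at the point \<open>x\<close> with \<open>f\<^sub>1 x = 0\<close>;
  both functions are exact second-order polynomials in the displacement \<open>d\<close> from \<open>x\<close>.

  From (GTR) to (GTRE): a quadratic function with a local minimum in the interior of a set is convex
  with a global minimum there, so \<open>f\<^sub>1 x = 0\<close>. If \<open>a = 0\<close>, then \<open>f\<^sub>1 (x + d) = d \<bullet> A\<^sub>1 d\<close>, the feasible set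
  is a cone symmetric about \<open>x\<close>, and local minimality is again global. So \<open>a \<noteq> 0\<close>, and the first-order
  condition on the half space \<open>a \<bullet> d < 0\<close> gives \<open>p = - \<mu> a\<close> with \<open>\<mu> \<ge> 0\<close>. If \<open>\<mu> = 0\<close>, the second-order
  condition on this half space makes \<open>A\<^sub>0\<close> positive semidefinite and \<open>x\<close> global; hence \<open>\<mu> > 0\<close>
  (\<open>GTR_positive_multiplier\<close>).

  It remains to see that \<open>x\<close> is not global for (GTRE), and this is where joint definiteness and
  \<open>n \<ge> 2\<close> enter (\<open>GTRE_global_imp_GTR_global\<close>). With \<open>H = A\<^sub>0 + \<mu> A\<^sub>1\<close>, stationarity of the Lagrangian says
  \<open>f\<^sub>0 (x + d) - f\<^sub>0 x + \<mu> f\<^sub>1 (x + d) = d \<bullet> H d\<close>.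
  If \<open>x\<close> were global on \<open>f\<^sub>1 = 0\<close>, then \<open>d \<bullet> H d \<ge> 0\<close> whenever the line through \<open>x\<close> in direction \<open>d\<close>
  meets the surface a second time, which happens if \<open>a \<bullet> d \<noteq> 0\<close> and \<open>d \<bullet> A\<^sub>1 d \<noteq> 0\<close>. Such directions are dense
  unless the form of \<open>A\<^sub>1\<close> vanishes, so \<open>H\<close> is positive semidefinite and \<open>f\<^sub>0 + \<mu> f\<^sub>1 \<ge> f\<^sub>0 x\<close> everywhere;
  this makes \<open>x\<close> global for (GTR). If the form of \<open>A\<^sub>1\<close> vanishes, the constraint is affine
  and \<open>A\<^sub>0\<close> itself is definite; it cannot be negative definite, because \<open>x\<close> minimizes \<open>f\<^sub>0\<close> on a
  hyperplane of positive dimension.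

  From (GTRE) to (GTR): moving from a nearby point of \<open>f\<^sub>1 < 0\<close> in the direction \<open>a\<close> reaches
  the surface \<open>f\<^sub>1 = 0\<close> close to \<open>x\<close>, and \<open>f\<^sub>0\<close> decreases on the way because \<open>p = - \<mu> a\<close> with \<open>\<mu> > 0\<close>. So local
  minimality on the surface carries over to \<open>f\<^sub>1 \<le> 0\<close> (\<open>GTRE_local_imp_GTR_local\<close>).
\<close>

section \<open>Quadratic functions along rays\<close>

lemma quad_add:
  fixes A :: "real ^ 'n ^ 'n"
  assumes "transpose A = A"
  shows "quad A b c (x + d) = quad A b c x + 2 * ((A *v x + b) \<bullet> d) + d \<bullet> (A *v d)"
proof -
  have "x \<bullet> (A *v d) = d \<bullet> (A *v x)"
    using assms by (metis dot_lmul_matrix inner_commute transpose_matrix_vector)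
  then show ?thesis
    by (simp add: quad_def algebra_simps inner_commute matrix_vector_right_distrib)
qed

lemma quad_add_scaleR:
  fixes A :: "real ^ 'n ^ 'n"
  assumes "transpose A = A"
  shows "quad A b c (x + t *\<^sub>R d) =
    quad A b c x + t * (2 * ((A *v x + b) \<bullet> d) + t * (d \<bullet> (A *v d)))"
  using assms by (simp add: quad_add algebra_simps matrix_vector_mult_scaleR)

lemma continuous_on_quad: "continuous_on S (quad A b c)"
  unfolding quad_def [abs_def] by (intro continuous_intros)

lemma tendsto_affine_at_right_0: "((\<lambda>t. u + t * v) \<longlongrightarrow> u) (at_right (0::real))" for u v :: real
proof -
  have "((\<lambda>t. u + t * v) \<longlongrightarrow> u + 0 * v) (at_right 0)" by (intro tendsto_intros)
  then show ?thesis by simp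
qed

lemma initial_slope_nonneg:
  fixes u v :: real
  assumes "\<forall>\<^sub>F t in at_right 0. 0 \<le> t * (u + t * v)"
  shows "0 \<le> u"
proof (rule tendsto_lowerbound [OF tendsto_affine_at_right_0])
  show "\<forall>\<^sub>F t in at_right 0. 0 \<le> u + t * v"
    using assms eventually_at_right_less [of 0]
    by eventually_elim (simp add: zero_le_mult_iff)
qed simp

lemma local_minimizer_ray:
  fixes f :: "'a::real_normed_vector \<Rightarrow> real"
  assumes "local_minimizer f S x" and "\<forall>\<^sub>F t in at_right 0. x + t *\<^sub>R d \<in> S"
  shows "\<forall>\<^sub>F t in at_right 0. f x \<le> f (x + t *\<^sub>R d)"
proof -
  obtain e where "e > 0" and e: "\<And>y. y \<in> S \<Longrightarrow> dist y x < e \<Longrightarrow> f x \<le> f y"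
    using assms(1) unfolding local_minimizer_def by blast
  have "((\<lambda>t. x + t *\<^sub>R d) \<longlongrightarrow> x + 0 *\<^sub>R d) (at_right 0)" by (intro tendsto_intros)
  then have "\<forall>\<^sub>F t in at_right 0. dist (x + t *\<^sub>R d) x < e"
    using \<open>e > 0\<close> by (simp add: tendsto_iff)
  with assms(2) show ?thesis by eventually_elim (rule e)
qed

section \<open>Situations in which a local minimizer is global\<close>

text \<open>Feasible directions come in opposite pairs, so the linear term of the quadratic function
  vanishes along each of them. What is left is \<open>t\<^sup>2\<close> times a constant, whose sign is already determined
  by small \<open>t\<close>.\<close>

lemma symmetric_star_local_imp_global:
  fixes A :: "real ^ 'n ^ 'n"
  assumes sym: "transpose A = A"
    and loc: "local_minimizer (quad A b c) S x"
    and star: "\<And>d t. x + d \<in> S \<Longrightarrow> x + t *\<^sub>R d \<in> S"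
  shows "global_minimizer (quad A b c) S x"
proof -
  have ge: "quad A b c x \<le> quad A b c (x + d)" if "x + d \<in> S" for d
  proof -
    let ?u = "2 * ((A *v x + b) \<bullet> d)" and ?v = "d \<bullet> (A *v d)"
    have fwd: "\<forall>\<^sub>F t in at_right 0. 0 \<le> t * (?u + t * ?v)"
      using local_minimizer_ray [OF loc, of d] star [OF that]
      by (simp add: quad_add_scaleR [OF sym])
    have "quad A b c (x + t *\<^sub>R (- d)) = quad A b c x + t * (- ?u + t * ?v)" for t
      using quad_add_scaleR [OF sym, of b c x "- t" d] by (simp add: algebra_simps)
    moreover have "x + t *\<^sub>R (- d) \<in> S" for t using star [OF that, of "- t"] by simp
    ultimately have bwd: "\<forall>\<^sub>F t in at_right 0. 0 \<le> t * (- ?u + t * ?v)"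
      using local_minimizer_ray [OF loc, of "- d"] by simp
    have "?u = 0" using initial_slope_nonneg [OF fwd] initial_slope_nonneg [OF bwd] by simp
    with fwd have "\<forall>\<^sub>F t in at_right 0. 0 \<le> t * (t * ?v)" by simp
    with eventually_at_right_less [of 0] have "\<forall>\<^sub>F t::real in at_right 0. 0 \<le> ?v"
      by eventually_elim (simp add: zero_le_mult_iff)
    then have "0 \<le> ?v" by simp
    with \<open>?u = 0\<close> show ?thesis by (simp add: quad_add [OF sym])
  qed
  have "quad A b c x \<le> quad A b c y" if "y \<in> S" for y
    using ge [of "y - x"] that by simp
  with loc show ?thesis by (auto simp: global_minimizer_def local_minimizer_def)
qed

text \<open>Near an interior point the constraint is invisible, so the whole space, which is trivially
  symmetric about \<open>x\<close>, may take the place of \<open>S\<close>.\<close>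

lemma interior_local_minimizer_imp_global:
  fixes A :: "real ^ 'n ^ 'n"
  assumes sym: "transpose A = A"
    and loc: "local_minimizer (quad A b c) S x" and int: "x \<in> interior S"
  shows "global_minimizer (quad A b c) S x"
proof -
  obtain e where "e > 0" and e: "\<And>y. y \<in> S \<Longrightarrow> dist y x < e \<Longrightarrow> quad A b c x \<le> quad A b c y"
    using loc unfolding local_minimizer_def by blast
  obtain r where "r > 0" and r: "ball x r \<subseteq> S"
    using int by (auto simp: mem_interior)
  have "quad A b c x \<le> quad A b c y" if "dist y x < min e r" for y
    using that r by (intro e) (auto simp: dist_commute)
  then have "local_minimizer (quad A b c) UNIV x"
    unfolding local_minimizer_def using \<open>e > 0\<close> \<open>r > 0\<close> by (metis UNIV_I min_less_iff_conj)
  then have "global_minimizer (quad A b c) UNIV x"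
    by (rule symmetric_star_local_imp_global [OF sym]) simp
  with loc show ?thesis by (auto simp: global_minimizer_def local_minimizer_def)
qed

text \<open>Where an active quadratic constraint has zero gradient it is homogeneous of degree two in the
  displacement, so both feasible sets are symmetric cones with apex \<open>x\<close>.\<close>

lemma critical_constraint_local_imp_global:
  fixes A\<^sub>0 A\<^sub>1 :: "real ^ 'n ^ 'n"
  assumes sym0: "transpose A\<^sub>0 = A\<^sub>0" and sym1: "transpose A\<^sub>1 = A\<^sub>1"
    and loc: "local_minimizer (quad A\<^sub>0 b\<^sub>0 c\<^sub>0) S x"
    and S: "S = GTR_feasible (quad A\<^sub>1 b\<^sub>1 c\<^sub>1) \<or> S = GTRE_feasible (quad A\<^sub>1 b\<^sub>1 c\<^sub>1)"
    and active: "quad A\<^sub>1 b\<^sub>1 c\<^sub>1 x = 0" and crit: "A\<^sub>1 *v x + b\<^sub>1 = 0"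
  shows "global_minimizer (quad A\<^sub>0 b\<^sub>0 c\<^sub>0) S x"
proof (rule symmetric_star_local_imp_global [OF sym0 loc])
  fix d t assume d: "x + d \<in> S"
  have form: "quad A\<^sub>1 b\<^sub>1 c\<^sub>1 (x + t *\<^sub>R d) = t\<^sup>2 * quad A\<^sub>1 b\<^sub>1 c\<^sub>1 (x + d)"
    by (simp add: quad_add_scaleR [OF sym1] quad_add [OF sym1] active crit power2_eq_square
        matrix_vector_mult_scaleR)
  show "x + t *\<^sub>R d \<in> S"
    using S d by (auto simp: GTR_feasible_def GTRE_feasible_def form mult_nonneg_nonpos)
qed

section \<open>Semidefiniteness from generic directions\<close>

lemma quadratic_eventually_nonzero:
  fixes \<alpha> \<beta> \<gamma> :: real
  assumes "\<not> (\<alpha> = 0 \<and> \<beta> = 0 \<and> \<gamma> = 0)"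
  shows "\<forall>\<^sub>F t in at_right 0. \<alpha> + t * (\<beta> + t * \<gamma>) \<noteq> 0"
proof -
  have "finite {t. poly [:\<alpha>, \<beta>, \<gamma>:] t = 0}"
    using assms by (intro poly_roots_finite) auto
  then have "\<forall>\<^sub>F t in at_right 0. t \<notin> {t. poly [:\<alpha>, \<beta>, \<gamma>:] t = 0}"
    using islimpt_finite islimpt_iff_eventually eventually_at_split by blast
  then show ?thesis by simp
qed

lemma form_add_scaleR:
  fixes B :: "real ^ 'n ^ 'n"
  shows "(d + t *\<^sub>R v) \<bullet> (B *v (d + t *\<^sub>R v)) =
    d \<bullet> (B *v d) + t * ((d \<bullet> (B *v v) + v \<bullet> (B *v d)) + t * (v \<bullet> (B *v v)))"
  by (simp add: algebra_simps matrix_vector_right_distrib matrix_vector_mult_scaleR)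

text \<open>The excluded directions are the zeros of two nonzero polynomials, hence nowhere dense, and
  the form of \<open>H\<close> is continuous. Concretely, one admissible direction \<open>v\<close> suffices: on the line
  \<open>d + t v\<close> both polynomials have a nonzero leading coefficient and so finitely many zeros, which
  makes \<open>d\<close> a limit of admissible directions.\<close>

lemma form_nonneg_if_generically_nonneg:
  fixes B H :: "real ^ 'n ^ 'n"
  assumes "a \<noteq> 0" and w: "w \<bullet> (B *v w) \<noteq> 0"
    and gen: "\<And>d. a \<bullet> d \<noteq> 0 \<Longrightarrow> d \<bullet> (B *v d) \<noteq> 0 \<Longrightarrow> 0 \<le> d \<bullet> (H *v d)"
  shows "0 \<le> d \<bullet> (H *v d)"
proof -
  have lin: "\<forall>\<^sub>F t in at_right 0. a \<bullet> (y + t *\<^sub>R v) \<noteq> 0" if "a \<bullet> v \<noteq> 0" for y v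
    using quadratic_eventually_nonzero [of "a \<bullet> y" "a \<bullet> v" 0] that
    by (simp add: inner_add_right)
  have form: "\<forall>\<^sub>F t in at_right 0. (y + t *\<^sub>R v) \<bullet> (B *v (y + t *\<^sub>R v)) \<noteq> 0"
    if "y \<bullet> (B *v y) \<noteq> 0 \<or> v \<bullet> (B *v v) \<noteq> 0" for y v
    unfolding form_add_scaleR using that by (intro quadratic_eventually_nonzero) blast
  \<comment> \<open>An admissible direction: perturb \<open>w\<close> towards \<open>a\<close>, which keeps the form of \<open>B\<close> nonzero and leaves
    the hyperplane orthogonal to \<open>a\<close>.\<close>
  have "a \<bullet> a \<noteq> 0" using \<open>a \<noteq> 0\<close> by simp
  from eventually_conj [OF lin [OF this, of w] form [OF disjI1, OF w, of a]]
  obtain v where v: "a \<bullet> v \<noteq> 0" "v \<bullet> (B *v v) \<noteq> 0"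
    using eventually_happens' [OF trivial_limit_at_right_real] by blast
  show ?thesis
  proof (rule tendsto_lowerbound)
    have "((\<lambda>t. (d + t *\<^sub>R v) \<bullet> (H *v (d + t *\<^sub>R v))) \<longlongrightarrow>
        d \<bullet> (H *v d) + 0 * ((d \<bullet> (H *v v) + v \<bullet> (H *v d)) + 0 * (v \<bullet> (H *v v)))) (at_right 0)"
      unfolding form_add_scaleR by (intro tendsto_intros)
    then show "((\<lambda>t. (d + t *\<^sub>R v) \<bullet> (H *v (d + t *\<^sub>R v))) \<longlongrightarrow> d \<bullet> (H *v d)) (at_right 0)"
      by simp
    show "\<forall>\<^sub>F t in at_right 0. 0 \<le> (d + t *\<^sub>R v) \<bullet> (H *v (d + t *\<^sub>R v))"
      using lin [OF v(1), of d] form [OF disjI2, OF v(2), of d] by eventually_elim (rule gen)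
  qed simp
qed

section \<open>Local minimizers of the inequality and of the equality problem\<close>

lemma inactive_imp_interior_GTR:
  assumes "quad A b c x < 0"
  shows "x \<in> interior (GTR_feasible (quad A b c))"
proof (rule interiorI)
  show "open {y. quad A b c y < 0}"
    by (intro open_Collect_less continuous_on_quad continuous_on_const)
qed (use assms in \<open>auto simp: GTR_feasible_def\<close>)

text \<open>This is the Karush--Kuhn--Tucker condition with strict complementarity. The objective does not
  decrease to first order in any direction strictly into the half space \<open>a \<bullet> d < 0\<close>, so \<open>p\<close> is a
  nonpositive multiple of \<open>a\<close>. If \<open>p\<close> were zero, the second-order term would be nonnegative on that half
  space, hence by \<open>d \<mapsto> - d\<close> and density everywhere, and \<open>x\<close> would be a global minimizer.\<close>

lemma GTR_positive_multiplier:
  fixes A\<^sub>0 A\<^sub>1 :: "real ^ 'n ^ 'n"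
  assumes sym0: "transpose A\<^sub>0 = A\<^sub>0" and sym1: "transpose A\<^sub>1 = A\<^sub>1"
    and loc: "local_minimizer (quad A\<^sub>0 b\<^sub>0 c\<^sub>0) (GTR_feasible (quad A\<^sub>1 b\<^sub>1 c\<^sub>1)) x"
    and nonglob: "\<not> global_minimizer (quad A\<^sub>0 b\<^sub>0 c\<^sub>0) (GTR_feasible (quad A\<^sub>1 b\<^sub>1 c\<^sub>1)) x"
    and active: "quad A\<^sub>1 b\<^sub>1 c\<^sub>1 x = 0" and a: "A\<^sub>1 *v x + b\<^sub>1 \<noteq> 0"
  obtains \<mu> where "\<mu> > 0" "A\<^sub>0 *v x + b\<^sub>0 + \<mu> *\<^sub>R (A\<^sub>1 *v x + b\<^sub>1) = 0"
proof -
  define p a where "p = A\<^sub>0 *v x + b\<^sub>0" and "a = A\<^sub>1 *v x + b\<^sub>1"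
  have "a \<noteq> 0" using \<open>A\<^sub>1 *v x + b\<^sub>1 \<noteq> 0\<close> by (simp add: a_def)
  have ray: "\<forall>\<^sub>F t in at_right 0. 0 \<le> t * (2 * (p \<bullet> d) + t * (d \<bullet> (A\<^sub>0 *v d)))"
    if "a \<bullet> d < 0" for d
  proof -
    have "\<forall>\<^sub>F t in at_right 0. 2 * (a \<bullet> d) + t * (d \<bullet> (A\<^sub>1 *v d)) < 0"
      using that by (intro order_tendstoD(2) [OF tendsto_affine_at_right_0]) simp
    with eventually_at_right_less [of 0]
    have "\<forall>\<^sub>F t in at_right 0. x + t *\<^sub>R d \<in> GTR_feasible (quad A\<^sub>1 b\<^sub>1 c\<^sub>1)"
      by eventually_elim
        (simp add: GTR_feasible_def quad_add_scaleR [OF sym1] active a_def mult_le_0_iff)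
    from local_minimizer_ray [OF loc this] show ?thesis
      by (simp add: quad_add_scaleR [OF sym0] p_def)
  qed
  have descent: "0 \<le> p \<bullet> d" if "a \<bullet> d < 0" for d
    using initial_slope_nonneg [OF ray [OF that]] by simp
  \<comment> \<open>\<open>r\<close> is the component of \<open>p\<close> orthogonal to \<open>a\<close>. The direction \<open>- r\<close> would show \<open>r = 0\<close>, but it lies on the
    boundary of the half space; it is approached by \<open>- r - t a\<close> with \<open>t\<close> tending to \<open>0\<close>.\<close>
  define \<mu> r where "\<mu> = - (p \<bullet> a) / (a \<bullet> a)" and "r = p + \<mu> *\<^sub>R a"
  have aa: "a \<bullet> a > 0" using \<open>a \<noteq> 0\<close> by simp
  have "a \<bullet> r = 0"
    using aa by (simp add: r_def \<mu>_def inner_diff_right inner_commute)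
  have pr: "p \<bullet> r = r \<bullet> r"
    using inner_add_left [of p "\<mu> *\<^sub>R a" r] \<open>a \<bullet> r = 0\<close> by (simp flip: r_def)
  have "0 \<le> \<mu>" using descent [of "- a"] aa by (simp add: \<mu>_def divide_nonpos_pos)
  have "\<forall>\<^sub>F t in at_right 0. - (r \<bullet> r) + t * - (p \<bullet> a) \<ge> 0"
    using eventually_at_right_less [of 0]
  proof eventually_elim
    case (elim t)
    with aa have "a \<bullet> (- r - t *\<^sub>R a) < 0"
      by (simp add: inner_diff_right \<open>a \<bullet> r = 0\<close>)
    from descent [OF this] show ?case by (simp add: inner_diff_right pr)
  qed
  then have "0 \<le> - (r \<bullet> r)"
    by (rule tendsto_lowerbound [OF tendsto_affine_at_right_0]) simp
  then have "r = 0" by (metis inner_ge_zero inner_eq_zero_iff neg_0_le_iff_le order_antisym)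
  have "\<mu> \<noteq> 0"
  proof
    assume "\<mu> = 0"
    with \<open>r = 0\<close> have "p = 0" by (simp add: r_def)
    have half: "0 \<le> d \<bullet> (A\<^sub>0 *v d)" if "a \<bullet> d < 0" for d
    proof -
      have "\<forall>\<^sub>F t::real in at_right 0. 0 \<le> d \<bullet> (A\<^sub>0 *v d)"
        using ray [OF that] eventually_at_right_less [of 0]
        by eventually_elim (simp add: \<open>p = 0\<close> zero_le_mult_iff)
      then show ?thesis by simp
    qed
    \<comment> \<open>Only \<open>a \<bullet> d \<noteq> 0\<close> has to be excluded, so the second form is taken to be the norm squared.\<close>
    have "0 \<le> d \<bullet> (A\<^sub>0 *v d)" for d
    proof (rule form_nonneg_if_generically_nonneg [where B = "mat 1" and w = a])
      fix d assume "a \<bullet> d \<noteq> 0"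
      then consider "a \<bullet> d < 0" | "a \<bullet> (- 1 *\<^sub>R d) < 0" by fastforce
      then show "0 \<le> d \<bullet> (A\<^sub>0 *v d)"
        using half [of d] half [of "- 1 *\<^sub>R d"]
        unfolding matrix_vector_mult_scaleR by cases simp_all
    qed (use \<open>a \<noteq> 0\<close> in simp_all)
    then have ge: "quad A\<^sub>0 b\<^sub>0 c\<^sub>0 x \<le> quad A\<^sub>0 b\<^sub>0 c\<^sub>0 (x + d)" for d
      using \<open>p = 0\<close> by (simp add: quad_add [OF sym0] p_def)
    have "quad A\<^sub>0 b\<^sub>0 c\<^sub>0 x \<le> quad A\<^sub>0 b\<^sub>0 c\<^sub>0 y" for y
      using ge [of "y - x"] by simp
    with nonglob loc show False by (auto simp: global_minimizer_def local_minimizer_def)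
  qed
  with \<open>0 \<le> \<mu>\<close> \<open>r = 0\<close> show thesis
    by (intro that [of \<mu>]) (simp_all add: r_def p_def a_def)
qed

text \<open>A point \<open>y\<close> near \<open>x\<close> with \<open>f\<^sub>1 y \<le> 0\<close> is pushed along \<open>a\<close> onto the surface. One step length \<open>S\<close>,
  chosen at \<open>x\<close>, serves all such \<open>y\<close>: at \<open>x + S a\<close> the constraint is strictly positive, and by continuity
  it remains so at \<open>y + S a\<close>, so the intermediate value theorem finds the surface before \<open>S\<close>.\<close>

lemma GTRE_local_imp_GTR_local:
  fixes A\<^sub>0 A\<^sub>1 :: "real ^ 'n ^ 'n"
  assumes sym0: "transpose A\<^sub>0 = A\<^sub>0" and sym1: "transpose A\<^sub>1 = A\<^sub>1"
    and loc: "local_minimizer (quad A\<^sub>0 b\<^sub>0 c\<^sub>0) (GTRE_feasible (quad A\<^sub>1 b\<^sub>1 c\<^sub>1)) x"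
    and "A\<^sub>1 *v x + b\<^sub>1 \<noteq> 0"
    and "\<mu> > 0" and "A\<^sub>0 *v x + b\<^sub>0 + \<mu> *\<^sub>R (A\<^sub>1 *v x + b\<^sub>1) = 0"
  shows "local_minimizer (quad A\<^sub>0 b\<^sub>0 c\<^sub>0) (GTR_feasible (quad A\<^sub>1 b\<^sub>1 c\<^sub>1)) x"
proof -
  let ?f0 = "quad A\<^sub>0 b\<^sub>0 c\<^sub>0" and ?f1 = "quad A\<^sub>1 b\<^sub>1 c\<^sub>1"
  define a where "a = A\<^sub>1 *v x + b\<^sub>1"
  have aa: "a \<bullet> a > 0" using assms by (simp add: a_def)
  have "A\<^sub>0 *v x + b\<^sub>0 = - \<mu> *\<^sub>R a"
    using assms(6) by (simp add: a_def eq_neg_iff_add_eq_0)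
  then have pa: "(A\<^sub>0 *v x + b\<^sub>0) \<bullet> a < 0" using aa \<open>\<mu> > 0\<close> by simp
  have active: "?f1 x = 0" using loc by (simp add: local_minimizer_def GTRE_feasible_def)
  obtain e where "e > 0" and e: "\<And>y. ?f1 y = 0 \<Longrightarrow> dist y x < e \<Longrightarrow> ?f0 x \<le> ?f0 y"
    using loc by (auto simp: local_minimizer_def GTRE_feasible_def)
  \<comment> \<open>The slope of the chord of \<open>f\<^sub>0\<close> from \<open>y\<close> to \<open>y + s a\<close>. It is affine in \<open>s\<close>, so it is negative on all of
    \<open>{0..S}\<close> once it is negative at both ends.\<close>
  define k where "k y s = 2 * ((A\<^sub>0 *v y + b\<^sub>0) \<bullet> a) + s * (a \<bullet> (A\<^sub>0 *v a))" for y s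
  have f0_slide: "?f0 (y + s *\<^sub>R a) = ?f0 y + s * k y s" for y s
    by (simp add: k_def quad_add_scaleR [OF sym0])
  have "\<forall>\<^sub>F s in at_right 0. s > 0 \<and> k x s < 0 \<and>
      0 < 2 * (a \<bullet> a) + s * (a \<bullet> (A\<^sub>1 *v a)) \<and> norm (s *\<^sub>R a) < e / 2"
  proof (intro eventually_conj)
    show "\<forall>\<^sub>F s in at_right 0. k x s < 0"
      unfolding k_def using pa by (intro order_tendstoD(2) [OF tendsto_affine_at_right_0]) simp
    show "\<forall>\<^sub>F s in at_right 0. 0 < 2 * (a \<bullet> a) + s * (a \<bullet> (A\<^sub>1 *v a))"
      using aa by (intro order_tendstoD(1) [OF tendsto_affine_at_right_0]) simp
    have "((\<lambda>s. norm (s *\<^sub>R a)) \<longlongrightarrow> norm (0 *\<^sub>R a)) (at_right 0)" by (intro tendsto_intros)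
    then show "\<forall>\<^sub>F s in at_right 0. norm (s *\<^sub>R a) < e / 2"
      using \<open>e > 0\<close> by (intro order_tendstoD(2)) auto
  qed (rule eventually_at_right_less)
  then obtain S where S: "S > 0" "k x S < 0" "0 < 2 * (a \<bullet> a) + S * (a \<bullet> (A\<^sub>1 *v a))"
      "norm (S *\<^sub>R a) < e / 2"
    using eventually_happens' [OF trivial_limit_at_right_real] by blast
  have "?f1 (x + S *\<^sub>R a) > 0"
    using S by (simp add: quad_add_scaleR [OF sym1] active a_def)
  moreover have "k x 0 < 0" using pa by (simp add: k_def)
  moreover have "continuous_on UNIV (\<lambda>y. ?f1 (y + S *\<^sub>R a))"
    by (rule continuous_on_compose2 [OF continuous_on_quad [of UNIV]]) (auto intro!: continuous_intros)
  moreover have "continuous_on UNIV (\<lambda>y. k y s)" for s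
    unfolding k_def by (intro continuous_intros)
  ultimately have "open {y. 0 < ?f1 (y + S *\<^sub>R a) \<and> k y 0 < 0 \<and> k y S < 0}" (is "open ?U")
    by (intro open_Collect_conj open_Collect_less continuous_on_const)
  moreover have "x \<in> ?U"
    using \<open>?f1 (x + S *\<^sub>R a) > 0\<close> \<open>k x 0 < 0\<close> S by simp
  ultimately obtain r where "r > 0" and r: "\<And>y. dist y x < r \<Longrightarrow> y \<in> ?U"
    by (auto simp: open_dist)
  have "?f0 x \<le> ?f0 y" if "?f1 y \<le> 0" "dist y x < min r (e / 2)" for y
  proof -
    have y: "0 < ?f1 (y + S *\<^sub>R a)" "k y 0 < 0" "k y S < 0" using r [of y] that by auto
    have "\<exists>s\<ge>0. s \<le> S \<and> ?f1 (y + s *\<^sub>R a) = 0"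
    proof (rule IVT')
      show "continuous_on {0..S} (\<lambda>s. ?f1 (y + s *\<^sub>R a))"
        by (rule continuous_on_compose2 [OF continuous_on_quad [of UNIV]])
          (auto intro!: continuous_intros)
    qed (use y S that in auto)
    then obtain s where s: "0 \<le> s" "s \<le> S" "?f1 (y + s *\<^sub>R a) = 0" by blast
    have "S * k y s = (S - s) * k y 0 + s * k y S" by (simp add: k_def algebra_simps)
    also have "\<dots> \<le> 0"
      using s y by (intro add_nonpos_nonpos mult_nonneg_nonpos) auto
    finally have "k y s \<le> 0" using S by (simp add: mult_le_0_iff)
    then have le: "?f0 (y + s *\<^sub>R a) \<le> ?f0 y"
      using s by (simp add: f0_slide mult_nonneg_nonpos)
    have "norm (s *\<^sub>R a) \<le> norm (S *\<^sub>R a)" using s by (simp add: mult_right_mono)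
    then have "dist (y + s *\<^sub>R a) x < e"
      using S(4) that norm_triangle_ineq [of "y - x" "s *\<^sub>R a"]
      by (simp add: dist_norm algebra_simps)
    from e [OF s(3) this] le show ?thesis by simp
  qed
  then have "\<exists>\<rho>>0. \<forall>y. ?f1 y \<le> 0 \<longrightarrow> dist y x < \<rho> \<longrightarrow> ?f0 x \<le> ?f0 y"
    using \<open>r > 0\<close> \<open>e > 0\<close> by (intro exI [of _ "min r (e / 2)"]) simp
  then show ?thesis
    using active by (simp add: local_minimizer_def GTR_feasible_def)
qed

text \<open>An S-lemma with equality in which the multiplier is already known: minimality on the surface
  forces the Hessian \<open>H\<close> of the Lagrangian to be positive semidefinite, so the Lagrangian is minimal at
  \<open>x\<close> over the whole space, and \<open>\<mu> > 0\<close> yields minimality on \<open>f\<^sub>1 \<le> 0\<close>. For an affine constraint the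
  surface is a hyperplane and says nothing about \<open>H\<close> in transversal directions; there definiteness decides
  the sign, and \<open>n \<ge> 2\<close> provides a direction within the hyperplane that excludes the negative sign.\<close>

lemma GTRE_global_imp_GTR_global:
  fixes A\<^sub>0 A\<^sub>1 :: "real ^ 'n ^ 'n"
  assumes sym0: "transpose A\<^sub>0 = A\<^sub>0" and sym1: "transpose A\<^sub>1 = A\<^sub>1"
    and glob: "global_minimizer (quad A\<^sub>0 b\<^sub>0 c\<^sub>0) (GTRE_feasible (quad A\<^sub>1 b\<^sub>1 c\<^sub>1)) x"
    and "A\<^sub>1 *v x + b\<^sub>1 \<noteq> 0"
    and "\<mu> > 0" and crit: "A\<^sub>0 *v x + b\<^sub>0 + \<mu> *\<^sub>R (A\<^sub>1 *v x + b\<^sub>1) = 0"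
    and jd: "jointly_definite A\<^sub>0 A\<^sub>1" and card: "CARD('n) \<ge> 2"
  shows "global_minimizer (quad A\<^sub>0 b\<^sub>0 c\<^sub>0) (GTR_feasible (quad A\<^sub>1 b\<^sub>1 c\<^sub>1)) x"
proof -
  let ?f0 = "quad A\<^sub>0 b\<^sub>0 c\<^sub>0" and ?f1 = "quad A\<^sub>1 b\<^sub>1 c\<^sub>1"
  define a where "a = A\<^sub>1 *v x + b\<^sub>1"
  have "a \<noteq> 0" using assms by (simp add: a_def)
  have active: "?f1 x = 0" using glob by (simp add: global_minimizer_def GTRE_feasible_def)
  define H where "H = A\<^sub>0 + \<mu> *\<^sub>R A\<^sub>1"
  have H: "d \<bullet> (H *v d) = d \<bullet> (A\<^sub>0 *v d) + \<mu> * (d \<bullet> (A\<^sub>1 *v d))" for d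
    by (simp add: H_def matrix_vector_mult_add_rdistrib inner_add_right
        flip: scaleR_matrix_vector_assoc)
  have "A\<^sub>0 *v x + b\<^sub>0 = - \<mu> *\<^sub>R a"
    using crit by (simp add: a_def eq_neg_iff_add_eq_0)
  then have "?f0 (x + d) = ?f0 x - 2 * \<mu> * (a \<bullet> d) + d \<bullet> (A\<^sub>0 *v d)" for d
    by (simp add: quad_add [OF sym0])
  moreover have "?f1 (x + d) = 2 * (a \<bullet> d) + d \<bullet> (A\<^sub>1 *v d)" for d
    by (simp add: quad_add [OF sym1] active a_def)
  ultimately have lagr: "?f0 (x + d) - ?f0 x + \<mu> * ?f1 (x + d) = d \<bullet> (H *v d)" for d
    by (simp add: H distrib_left)
  have surface: "0 \<le> d \<bullet> (H *v d)" if "?f1 (x + d) = 0" for d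
  proof -
    have "?f0 x \<le> ?f0 (x + d)"
      using glob that by (simp add: global_minimizer_def GTRE_feasible_def)
    with lagr [of d] that show ?thesis by simp
  qed
  have "0 \<le> d \<bullet> (H *v d)" for d
  proof (cases "\<exists>w. w \<bullet> (A\<^sub>1 *v w) \<noteq> 0")
    case True
    then obtain w where w: "w \<bullet> (A\<^sub>1 *v w) \<noteq> 0" by blast
    show ?thesis
    proof (rule form_nonneg_if_generically_nonneg [OF \<open>a \<noteq> 0\<close> w])
      fix d assume d: "a \<bullet> d \<noteq> 0" "d \<bullet> (A\<^sub>1 *v d) \<noteq> 0"
      \<comment> \<open>The second intersection of the line \<open>x + t d\<close> with the surface.\<close>
      define t where "t = - 2 * (a \<bullet> d) / (d \<bullet> (A\<^sub>1 *v d))"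
      have "t \<noteq> 0" using d by (simp add: t_def)
      have "?f1 (x + t *\<^sub>R d) = 0"
        using d by (simp only: quad_add_scaleR [OF sym1] active a_def [symmetric]) (simp add: t_def)
      from surface [OF this] have "0 \<le> t\<^sup>2 * (d \<bullet> (H *v d))"
        by (simp add: matrix_vector_mult_scaleR power2_eq_square)
      with \<open>t \<noteq> 0\<close> show "0 \<le> d \<bullet> (H *v d)" by (simp add: zero_le_mult_iff)
    qed
  next
    case False
    then have A1: "v \<bullet> (A\<^sub>1 *v v) = 0" for v by blast
    obtain v where "v \<noteq> 0" "a \<bullet> v = 0"
      using orthogonal_to_vector_exists [of a] card by (auto simp: orthogonal_def)
    have "?f1 (x + v) = 0"
      by (simp add: quad_add [OF sym1] active a_def [symmetric] A1 \<open>a \<bullet> v = 0\<close>)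
    from surface [OF this] have v: "0 \<le> v \<bullet> (A\<^sub>0 *v v)" by (simp add: H A1)
    obtain \<nu> where "pos_def_matrix (A\<^sub>0 + \<nu> *\<^sub>R A\<^sub>1) \<or> neg_def_matrix (A\<^sub>0 + \<nu> *\<^sub>R A\<^sub>1)"
      using jd unfolding jointly_definite_def by blast
    moreover have "u \<bullet> ((A\<^sub>0 + \<nu> *\<^sub>R A\<^sub>1) *v u) = u \<bullet> (A\<^sub>0 *v u)" for u
      by (simp add: matrix_vector_mult_add_rdistrib inner_add_right A1
          flip: scaleR_matrix_vector_assoc)
    ultimately have "(\<forall>u. u \<noteq> 0 \<longrightarrow> 0 < u \<bullet> (A\<^sub>0 *v u)) \<or> (\<forall>u. u \<noteq> 0 \<longrightarrow> u \<bullet> (A\<^sub>0 *v u) < 0)"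
      by (auto simp: pos_def_matrix_def neg_def_matrix_def)
    with v \<open>v \<noteq> 0\<close> have "\<forall>u. u \<noteq> 0 \<longrightarrow> 0 < u \<bullet> (A\<^sub>0 *v u)" by force
    then show ?thesis by (cases "d = 0") (auto simp: H A1 less_imp_le)
  qed
  then have ge: "0 \<le> ?f0 (x + d) - ?f0 x + \<mu> * ?f1 (x + d)" for d
    by (simp only: lagr)
  have "?f0 x \<le> ?f0 y + \<mu> * ?f1 y" for y
    using ge [of "y - x"] by simp
  moreover have "\<mu> * ?f1 y \<le> 0" if "?f1 y \<le> 0" for y
    using that \<open>\<mu> > 0\<close> by (simp add: mult_nonneg_nonpos)
  ultimately have "?f0 x \<le> ?f0 y" if "?f1 y \<le> 0" for y
    using that by (meson add_decreasing2 order_refl order_trans)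
  with active show ?thesis by (simp add: global_minimizer_def GTR_feasible_def)
qed

lemma lagrangian_multiplier_quad_iff:
  fixes A\<^sub>0 A\<^sub>1 :: "real ^ 'n ^ 'n"
  assumes "transpose A\<^sub>0 = A\<^sub>0" and "transpose A\<^sub>1 = A\<^sub>1"
  shows "lagrangian_multiplier (quad A\<^sub>0 b\<^sub>0 c\<^sub>0) (quad A\<^sub>1 b\<^sub>1 c\<^sub>1) x \<mu> \<longleftrightarrow>
    A\<^sub>0 *v x + b\<^sub>0 + \<mu> *\<^sub>R (A\<^sub>1 *v x + b\<^sub>1) = 0"
proof -
  have "gradient (quad A\<^sub>0 b\<^sub>0 c\<^sub>0) x + \<mu> *\<^sub>R gradient (quad A\<^sub>1 b\<^sub>1 c\<^sub>1) x =
      2 *\<^sub>R (A\<^sub>0 *v x + b\<^sub>0 + \<mu> *\<^sub>R (A\<^sub>1 *v x + b\<^sub>1))"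
    by (simp add: gradient_quad assms algebra_simps)
  then show ?thesis by (simp add: lagrangian_multiplier_def)
qed

theorem theorem2p22:
  fixes A\<^sub>0 A\<^sub>1 :: "real ^ 'n ^ 'n" and b\<^sub>0 b\<^sub>1 :: "real ^ 'n" and c\<^sub>1 :: real
    and f\<^sub>0 f\<^sub>1 :: "real ^ 'n \<Rightarrow> real" and x :: "real ^ 'n"
  assumes "transpose A\<^sub>0 = A\<^sub>0" and "transpose A\<^sub>1 = A\<^sub>1"
    and "f\<^sub>0 = quad A\<^sub>0 b\<^sub>0 0" and "f\<^sub>1 = quad A\<^sub>1 b\<^sub>1 c\<^sub>1"
    and "jointly_definite A\<^sub>0 A\<^sub>1"
    and "CARD('n) \<ge> 2"
  shows "local_nonglobal_minimizer f\<^sub>0 (GTR_feasible f\<^sub>1) x \<longleftrightarrow>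
    local_nonglobal_minimizer f\<^sub>0 (GTRE_feasible f\<^sub>1) x \<and>
    (\<exists>\<mu>>0. lagrangian_multiplier f\<^sub>0 f\<^sub>1 x \<mu>)"
proof
  note f = assms(3,4)
  note sym = assms(1,2)
  have sub: "GTRE_feasible f\<^sub>1 \<subseteq> GTR_feasible f\<^sub>1"
    by (auto simp: GTR_feasible_def GTRE_feasible_def)
  {
    assume "local_nonglobal_minimizer f\<^sub>0 (GTR_feasible f\<^sub>1) x"
    then have loc: "local_minimizer f\<^sub>0 (GTR_feasible f\<^sub>1) x"
      and nonglob: "\<not> global_minimizer f\<^sub>0 (GTR_feasible f\<^sub>1) x"
      by (simp_all add: local_nonglobal_minimizer_def)
    have "\<not> f\<^sub>1 x < 0"
      using nonglob loc interior_local_minimizer_imp_global [OF sym(1)] inactive_imp_interior_GTR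
      unfolding f by blast
    moreover have "f\<^sub>1 x \<le> 0" using loc by (simp add: local_minimizer_def GTR_feasible_def)
    ultimately have active: "f\<^sub>1 x = 0" by simp
    have crit: "A\<^sub>1 *v x + b\<^sub>1 \<noteq> 0"
      using critical_constraint_local_imp_global [OF sym] loc nonglob active unfolding f by blast
    obtain \<mu> where \<mu>: "\<mu> > 0" "A\<^sub>0 *v x + b\<^sub>0 + \<mu> *\<^sub>R (A\<^sub>1 *v x + b\<^sub>1) = 0"
      using GTR_positive_multiplier [OF sym loc [unfolded f] nonglob [unfolded f]] active crit
      unfolding f by blast
    have "local_minimizer f\<^sub>0 (GTRE_feasible f\<^sub>1) x"
      using loc active sub unfolding local_minimizer_def by (auto simp: GTRE_feasible_def)
    moreover have "\<not> global_minimizer f\<^sub>0 (GTRE_feasible f\<^sub>1) x"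
      using GTRE_global_imp_GTR_global [OF sym _ crit \<mu> assms(5,6)] nonglob unfolding f by blast
    ultimately show "local_nonglobal_minimizer f\<^sub>0 (GTRE_feasible f\<^sub>1) x \<and>
        (\<exists>\<mu>>0. lagrangian_multiplier f\<^sub>0 f\<^sub>1 x \<mu>)"
      using \<mu> by (auto simp: local_nonglobal_minimizer_def f lagrangian_multiplier_quad_iff [OF sym])
  next
    assume "local_nonglobal_minimizer f\<^sub>0 (GTRE_feasible f\<^sub>1) x \<and>
        (\<exists>\<mu>>0. lagrangian_multiplier f\<^sub>0 f\<^sub>1 x \<mu>)"
    then obtain \<mu> where loc: "local_minimizer f\<^sub>0 (GTRE_feasible f\<^sub>1) x"
      and nonglob: "\<not> global_minimizer f\<^sub>0 (GTRE_feasible f\<^sub>1) x"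
      and \<mu>: "\<mu> > 0" "A\<^sub>0 *v x + b\<^sub>0 + \<mu> *\<^sub>R (A\<^sub>1 *v x + b\<^sub>1) = 0"
      by (auto simp: local_nonglobal_minimizer_def f lagrangian_multiplier_quad_iff [OF sym])
    have active: "f\<^sub>1 x = 0" using loc by (simp add: local_minimizer_def GTRE_feasible_def)
    have crit: "A\<^sub>1 *v x + b\<^sub>1 \<noteq> 0"
      using critical_constraint_local_imp_global [OF sym] loc nonglob active unfolding f by blast
    have "local_minimizer f\<^sub>0 (GTR_feasible f\<^sub>1) x"
      using GTRE_local_imp_GTR_local [OF sym _ crit \<mu>] loc unfolding f by blast
    moreover have "\<not> global_minimizer f\<^sub>0 (GTR_feasible f\<^sub>1) x"
      using nonglob active sub by (auto simp: global_minimizer_def GTRE_feasible_def)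
    ultimately show "local_nonglobal_minimizer f\<^sub>0 (GTR_feasible f\<^sub>1) x"
      by (simp add: local_nonglobal_minimizer_def)
  }
qed

end
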